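(* Let $(R,\mathfrak m,k)\subset(S,\mathfrak n,l)$ be an extension of local rings such that the fiber $S/\mathfrak mS$ of $R\to S$ is reduced, $k\subset l$ is algebraic, and $k$ has characteristic zero. Then $I^{\mathrm{sat}}S=(IS)^{\mathrm{sat}}$ holds for some $\mathfrak m$-primary ideal $I$ in $R$ if and only if the inclusion $R\subset S$ is unramified.
   Context: Local rings are Noetherian, and an extension of local rings is an injective local homomorphism. For an ideal $K$ of a local ring $(A,\mathfrak m_A)$, the saturation of $K$ is $K^{\mathrm{sat}}=\bigcup_{i\ge 1}(K:_A\mathfrak m_A^i)$; so $I^{\mathrm{sat}}$ is computed in $R$ and $(IS)^{\mathrm{sat}}$ in $S$. An extension $(R,\mathfrak m,k)\subset(S,\mathfrak n,l)$ of local rings with residue fields $k,l$ is unramified if $\mathfrak mS=\mathfrak n$ and $k\to l$ is separable algebraic. *)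

theory Defs
  imports "HOL-Algebra.QuotRing" "HOL-Algebra.Ideal_Product" "HOL-Algebra.Finite_Extensions"
begin

section \<open>Ideals\<close>

definition colon :: "('a, 'c) ring_scheme \<Rightarrow> 'a set \<Rightarrow> 'a set \<Rightarrow> 'a set"
  where "colon A K J = {x \<in> carrier A. \<forall>y\<in>J. x \<otimes>\<^bsub>A\<^esub> y \<in> K}"

text \<open>Powers of ideals are powers in \<^const>\<open>ideals_set\<close>, whose multiplication is the product
  of ideals.\<close>

definition saturation :: "('a, 'c) ring_scheme \<Rightarrow> 'a set \<Rightarrow> 'a set \<Rightarrow> 'a set"
  where "saturation A M K = (\<Union>i\<in>{1::nat..}. colon A K (M [^]\<^bsub>ideals_set A\<^esub> i))"

definition radical :: "('a, 'c) ring_scheme \<Rightarrow> 'a set \<Rightarrow> 'a set"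
  where "radical A I = {x \<in> carrier A. \<exists>i>0::nat. x [^]\<^bsub>A\<^esub> i \<in> I}"

locale primaryideal = ideal I A + cring A for I and A (structure) +
  assumes I_notcarr: "carrier A \<noteq> I"
    and I_primary: "\<lbrakk>a \<in> carrier A; b \<in> carrier A; a \<otimes> b \<in> I\<rbrakk>
      \<Longrightarrow> a \<in> I \<or> (\<exists>i>0::nat. b [^] i \<in> I)"

definition primary_to :: "('a, 'c) ring_scheme \<Rightarrow> 'a set \<Rightarrow> 'a set \<Rightarrow> bool"
  where "primary_to A M I \<longleftrightarrow> primaryideal I A \<and> radical A I = M"

definition reduced_ring :: "('a, 'c) ring_scheme \<Rightarrow> bool"
  where "reduced_ring A \<longleftrightarrow>
    cring A \<and> (\<forall>x\<in>carrier A. (\<exists>i>0::nat. x [^]\<^bsub>A\<^esub> i = \<zero>\<^bsub>A\<^esub>) \<longrightarrow> x = \<zero>\<^bsub>A\<^esub>)"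


section \<open>Fields\<close>

definition char_zero :: "('a, 'c) ring_scheme \<Rightarrow> bool"
  where "char_zero A \<longleftrightarrow> (\<forall>i>0::nat. [i] \<cdot>\<^bsub>A\<^esub> \<one>\<^bsub>A\<^esub> \<noteq> \<zero>\<^bsub>A\<^esub>)"

text \<open>Polynomials are coefficient lists with the leading coefficient first, so the list below
  has the entries \<open>i \<cdot> coeff p i\<close> for \<open>i = degree p, \<dots>, 1\<close>; normalizing is needed because
  leading entries may vanish in positive characteristic.\<close>

definition formal_deriv :: "('a, 'c) ring_scheme \<Rightarrow> 'a list \<Rightarrow> 'a list"
  where "formal_deriv A p =
    ring.normalize A (map (\<lambda>i::nat. [i] \<cdot>\<^bsub>A\<^esub> ring.coeff A p i) (rev [1..<length p]))"

text \<open>Here \<open>K\<close> is a subfield of \<open>L\<close>, as in \<^theory>\<open>HOL-Algebra.Finite_Extensions\<close>; the minimal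
  polynomial of a separable element is coprime in \<open>K[X]\<close> to its derivative.\<close>

definition separable_elem :: "('a, 'c) ring_scheme \<Rightarrow> 'a set \<Rightarrow> 'a \<Rightarrow> bool"
  where "separable_elem L K x \<longleftrightarrow> (ring.algebraic L over K) x \<and>
    isgcd (univ_poly L K) \<one>\<^bsub>univ_poly L K\<^esub> (ring.Irr L K x) (formal_deriv L (ring.Irr L K x))"

definition algebraic_extension :: "('a, 'c) ring_scheme \<Rightarrow> 'a set \<Rightarrow> bool"
  where "algebraic_extension L K \<longleftrightarrow> (\<forall>x\<in>carrier L. (ring.algebraic L over K) x)"

definition separable_extension :: "('a, 'c) ring_scheme \<Rightarrow> 'a set \<Rightarrow> bool"
  where "separable_extension L K \<longleftrightarrow> (\<forall>x\<in>carrier L. separable_elem L K x)"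


section \<open>Extensions of local rings\<close>

locale local_ring = cring R + noetherian_ring R for R (structure) and \<mm> +
  assumes maximal: "maximalideal \<mm> R"
    and unique_maximal: "maximalideal M R \<Longrightarrow> M = \<mm>"

locale local_extension =
  R: local_ring R \<mm> + S: local_ring S \<nn> for R (structure) and \<mm> and S (structure) and \<nn> +
  fixes h
  assumes hom: "h \<in> ring_hom R S"
    and inj: "inj_on h (carrier R)"
    and local_hom: "h ` \<mm> \<subseteq> \<nn>"

text \<open>The map \<open>R/\<mm> \<rightarrow> S/\<nn>\<close> induced by \<open>h\<close>; the cosets in the union all agree when \<open>h\<close> is local.\<close>

definition residue_map :: "('b, 'd) ring_scheme \<Rightarrow> 'b set \<Rightarrow> ('a \<Rightarrow> 'b) \<Rightarrow> 'a set \<Rightarrow> 'b set"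
  where "residue_map S \<nn> h C = (\<Union>x\<in>C. \<nn> +>\<^bsub>S\<^esub> h x)"

lemma (in local_extension) residue_map_coset:
  assumes x: "x \<in> carrier R"
  shows "residue_map S \<nn> h (\<mm> +>\<^bsub>R\<^esub> x) = \<nn> +>\<^bsub>S\<^esub> h x"
proof -
  interpret m: maximalideal \<mm> R by (rule R.maximal)
  interpret n: maximalideal \<nn> S by (rule S.maximal)
  have hx: "h x \<in> carrier S" using hom x by (rule ring_hom_closed)
  have "\<nn> +>\<^bsub>S\<^esub> h y = \<nn> +>\<^bsub>S\<^esub> h x" if "y \<in> \<mm> +>\<^bsub>R\<^esub> x" for y
  proof -
    from that obtain a where a: "a \<in> \<mm>" "y = a \<oplus>\<^bsub>R\<^esub> x" by (auto simp: a_r_coset_def')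
    have "h y = h a \<oplus>\<^bsub>S\<^esub> h x"
      using a x m.Icarr by (simp add: ring_hom_add[OF hom])
    moreover have "h a \<in> \<nn>" using a local_hom by auto
    ultimately have "h y \<in> \<nn> +>\<^bsub>S\<^esub> h x" by (auto simp: a_r_coset_def')
    then show ?thesis using n.a_repr_independence'[OF _ hx] by simp
  qed
  moreover have "x \<in> \<mm> +>\<^bsub>R\<^esub> x" using m.a_rcos_self[OF x] .
  ultimately show ?thesis unfolding residue_map_def by blast
qed

text \<open>The image of \<open>k = R/\<mm>\<close> in \<open>l = S/\<nn>\<close>.\<close>

definition residue_image ::
    "('a, 'c) ring_scheme \<Rightarrow> 'a set \<Rightarrow> ('b, 'd) ring_scheme \<Rightarrow> 'b set \<Rightarrow> ('a \<Rightarrow> 'b) \<Rightarrow> 'b set set"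
  where "residue_image R \<mm> S \<nn> h = residue_map S \<nn> h ` carrier (R Quot \<mm>)"

definition unramified ::
    "('a, 'c) ring_scheme \<Rightarrow> 'a set \<Rightarrow> ('b, 'd) ring_scheme \<Rightarrow> 'b set \<Rightarrow> ('a \<Rightarrow> 'b) \<Rightarrow> bool"
  where "unramified R \<mm> S \<nn> h \<longleftrightarrow>
    Idl\<^bsub>S\<^esub> (h ` \<mm>) = \<nn> \<and> separable_extension (S Quot \<nn>) (residue_image R \<mm> S \<nn> h)"

end

theory Submission
  imports Defs
begin

text \<open>
  The saturation of an ideal \<open>K\<close> of a local ring is the whole ring exactly when \<open>K\<close> contains a power
  of the maximal ideal (\<open>saturation_eq_carrier_iff\<close>).  If \<open>I\<close> is \<open>\<mm>\<close>-primary, then every element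
  of \<open>\<mm>\<close> has a power in \<open>I\<close>; as \<open>\<mm>\<close> is finitely generated, \<open>I\<close> contains a power of \<open>\<mm>\<close>
  (\<open>power_subset_of_generators_in_radical\<close>), so that \<open>I\<^sup>s\<^sup>a\<^sup>t = R\<close>.  The equation
  \<open>I\<^sup>s\<^sup>a\<^sup>tS = (IS)\<^sup>s\<^sup>a\<^sup>t\<close> thus says that \<open>\<nn>\<^sup>i \<subseteq> IS\<close> for some \<open>i\<close>.

  Such an inclusion makes every element of \<open>\<nn>\<close> nilpotent modulo \<open>\<mm>S\<close>, hence zero there because the
  fiber is reduced, and \<open>\<mm>S = \<nn>\<close> follows.  Conversely, if \<open>\<mm>S = \<nn>\<close>, then \<open>I = \<mm>\<close> satisfies the
  equation.  The remaining half of being unramified, separability of the residue field extension,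
  comes from characteristic zero: the derivative of an irreducible polynomial is a nonzero polynomial
  of smaller degree, so the two are coprime (\<open>separable_elem_of_char_zero\<close>).
\<close>


section \<open>Powers of ideals and saturation\<close>

lemma ideal_prod_mono:
  assumes "I \<subseteq> I'" "J \<subseteq> J'"
  shows "I \<cdot>\<^bsub>R\<^esub> J \<subseteq> I' \<cdot>\<^bsub>R\<^esub> J'"
proof
  fix x assume "x \<in> I \<cdot>\<^bsub>R\<^esub> J"
  then show "x \<in> I' \<cdot>\<^bsub>R\<^esub> J'"
    by induction (use assms in \<open>auto intro: ideal_prod.intros\<close>)
qed

lemma ideal_pow_0: "I [^]\<^bsub>ideals_set R\<^esub> (0::nat) = carrier R"
  by (simp add: ideals_set_def)

lemma ideal_pow_Suc: "I [^]\<^bsub>ideals_set R\<^esub> Suc n = (I [^]\<^bsub>ideals_set R\<^esub> n) \<cdot>\<^bsub>R\<^esub> I"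
  by (simp add: ideals_set_def)

lemma ideal_pow_mono:
  assumes "I \<subseteq> J"
  shows "I [^]\<^bsub>ideals_set R\<^esub> (n::nat) \<subseteq> J [^]\<^bsub>ideals_set R\<^esub> n"
  by (induction n) (simp_all only: ideal_pow_0 ideal_pow_Suc ideal_prod_mono assms subset_refl)

lemma pow_mem_ideal_pow:
  assumes "monoid R" "x \<in> I"
  shows "x [^]\<^bsub>R\<^esub> n \<in> I [^]\<^bsub>ideals_set R\<^esub> (n::nat)"
proof (induction n)
  case 0
  show ?case unfolding ideal_pow_0 using assms(1) by (simp add: monoid.one_closed)
next
  case (Suc n)
  then show ?case unfolding ideal_pow_Suc using assms(2) by (simp add: ideal_prod.prod)
qed

context cring
begin

lemma ideal_pow_ideal:
  assumes "ideal I R"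
  shows "ideal (I [^]\<^bsub>ideals_set R\<^esub> (n::nat)) R"
  by (induction n) (simp_all only: ideal_pow_0 ideal_pow_Suc oneideal ideal_prod_is_ideal assms)

lemma ideal_pow_pow:
  assumes "ideal I R"
  shows "(I [^]\<^bsub>ideals_set R\<^esub> (m::nat)) [^]\<^bsub>ideals_set R\<^esub> (n::nat) = I [^]\<^bsub>ideals_set R\<^esub> (m * n)"
proof -
  interpret M: comm_monoid "ideals_set R" by (rule ideals_set_is_comm_monoid)
  show ?thesis using assms by (intro M.nat_pow_pow) (simp add: ideals_set_def)
qed

lemma ideal_pow_1:
  assumes "ideal I R"
  shows "I [^]\<^bsub>ideals_set R\<^esub> (1::nat) = I"
proof -
  interpret M: comm_monoid "ideals_set R" by (rule ideals_set_is_comm_monoid)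
  have "I \<in> carrier (ideals_set R)" using assms by (simp add: ideals_set_def)
  then show ?thesis by simp
qed

lemma cgenideal_pow:
  assumes "a \<in> carrier R"
  shows "(PIdl a) [^]\<^bsub>ideals_set R\<^esub> (n::nat) = PIdl (a [^] n)"
proof (induction n)
  case 0
  show ?case
    unfolding ideal_pow_0 by (simp add: cgenideal_eq_genideal genideal_one)
next
  case (Suc n)
  have "(PIdl (a [^] n)) \<cdot> (PIdl a) = Idl (PIdl (a [^] n) <#> PIdl a)"
    using assms by (intro ideal_prod_eq_genideal cgenideal_ideal) auto
  also have "\<dots> = Idl (PIdl (a [^] Suc n))"
    using assms by (simp add: cgenideal_prod)
  also have "\<dots> = PIdl (a [^] Suc n)"
  proof -
    interpret ideal "PIdl (a [^] Suc n)" R using assms by (intro cgenideal_ideal) auto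
    show ?thesis
      using genideal_minimal[OF is_ideal subset_refl] genideal_self[OF a_subset] by blast
  qed
  finally show ?case unfolding ideal_pow_Suc Suc .
qed

text \<open>Expanding the power, every term other than the power of \<open>J\<close> has a factor in \<open>K\<close>.\<close>

lemma ideal_pow_add_subset:
  assumes J: "ideal J R" and K: "ideal K R"
  shows "(J <+>\<^bsub>R\<^esub> K) [^]\<^bsub>ideals_set R\<^esub> (n::nat) \<subseteq> J [^]\<^bsub>ideals_set R\<^esub> n <+>\<^bsub>R\<^esub> K"
proof (induction n)
  case 0
  have "carrier R \<union> K \<subseteq> carrier R <+>\<^bsub>R\<^esub> K"
    using genideal_self[of "carrier R \<union> K"] union_genideal[OF oneideal K]
      ideal.Icarr[OF K] by auto
  then show ?case unfolding ideal_pow_0 by simp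
next
  case (Suc n)
  let ?P = "J [^]\<^bsub>ideals_set R\<^esub> n"
  interpret J: ideal J R by (rule J)
  interpret K: ideal K R by (rule K)
  interpret P: ideal ?P R by (rule ideal_pow_ideal[OF J])
  interpret PJ: ideal "?P \<cdot> J" R by (rule ideal_prod_is_ideal[OF P.is_ideal J])
  interpret T: ideal "(?P \<cdot> J) <+>\<^bsub>R\<^esub> K" R by (rule add_ideals[OF PJ.is_ideal K])
  have "(?P <+>\<^bsub>R\<^esub> K) \<cdot> (J <+>\<^bsub>R\<^esub> K) \<subseteq> ?P \<cdot> J <+>\<^bsub>R\<^esub> K"
  proof
    fix z assume "z \<in> (?P <+>\<^bsub>R\<^esub> K) \<cdot> (J <+>\<^bsub>R\<^esub> K)"
    then show "z \<in> ?P \<cdot> J <+>\<^bsub>R\<^esub> K"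
    proof induction
      case (prod i j)
      then obtain x y x' y' where xy: "x \<in> ?P" "y \<in> K" "i = x \<oplus> y"
        and xy': "x' \<in> J" "y' \<in> K" "j = x' \<oplus> y'"
        unfolding set_add_def' by blast
      note carr = P.Icarr[OF xy(1)] K.Icarr[OF xy(2)] J.Icarr[OF xy'(1)] K.Icarr[OF xy'(2)]
      have "i \<otimes> j = x \<otimes> x' \<oplus> (x \<otimes> y' \<oplus> y \<otimes> (x' \<oplus> y'))"
        unfolding xy(3) xy'(3) using carr by algebra
      moreover have "x \<otimes> y' \<oplus> y \<otimes> (x' \<oplus> y') \<in> K"
        using xy(2) xy'(2) carr by (intro K.a_closed K.I_l_closed K.I_r_closed) auto
      moreover have "x \<otimes> x' \<in> ?P \<cdot> J" using xy(1) xy'(1) by (rule ideal_prod.prod)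
      ultimately show ?case unfolding set_add_def' by blast
    next
      case (sum s t)
      then show ?case by (intro T.a_closed)
    qed
  qed
  then show ?case
    unfolding ideal_pow_Suc using ideal_prod_mono[OF Suc subset_refl] by blast
qed

lemma add_ideals_subset:
  assumes "ideal I R" "J \<subseteq> I" "K \<subseteq> I"
  shows "J <+>\<^bsub>R\<^esub> K \<subseteq> I"
proof -
  interpret ideal I R by fact
  show ?thesis unfolding set_add_def' using assms(2,3) by (blast intro: a_closed)
qed

text \<open>Adding one generator \<open>a\<close> to an ideal \<open>J\<close>: if \<open>J\<^sup>n\<close> and \<open>a\<^sup>k\<close> lie in \<open>I\<close>, then the \<open>k\<close>-th power
  of \<open>J + (a)\<close> lies in \<open>J + I\<close>, and the \<open>n\<close>-th power of \<open>J + I\<close> lies in \<open>I\<close>.\<close>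

lemma power_subset_of_generators_in_radical:
  assumes I: "ideal I R" and A: "finite A" "A \<subseteq> radical R I"
  shows "\<exists>n\<ge>1::nat. (Idl A) [^]\<^bsub>ideals_set R\<^esub> n \<subseteq> I"
  using A
proof (induction A rule: finite_induct)
  case empty
  interpret I: ideal I R by (rule I)
  have "(Idl {}) [^]\<^bsub>ideals_set R\<^esub> (1::nat) = Idl {}"
    by (intro ideal_pow_1 genideal_ideal) auto
  also have "\<dots> \<subseteq> I" using genideal_minimal[OF I] by simp
  finally show ?case by blast
next
  case (insert a A)
  then obtain n where n: "n \<ge> (1::nat)" "(Idl A) [^]\<^bsub>ideals_set R\<^esub> n \<subseteq> I" by auto
  from insert.prems obtain k where a: "a \<in> carrier R" and k: "k > (0::nat)" "a [^] k \<in> I"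
    by (auto simp: radical_def)
  have Ac: "A \<subseteq> carrier R" using insert.prems by (auto simp: radical_def)
  have J: "ideal (Idl A) R" using Ac by (rule genideal_ideal)
  have K: "ideal (PIdl a) R" using a by (rule cgenideal_ideal)
  have KJ: "ideal (PIdl a <+>\<^bsub>R\<^esub> Idl A) R" by (rule add_ideals[OF K J])
  have IA: "ideal (Idl A <+>\<^bsub>R\<^esub> I) R" by (rule add_ideals[OF J I])
  interpret I: ideal I R by (rule I)
  interpret J: ideal "Idl A" R by (rule J)
  interpret K: ideal "PIdl a" R by (rule K)
  have sub: "Idl A \<union> I \<subseteq> Idl A <+>\<^bsub>R\<^esub> I"
    using genideal_self[of "Idl A \<union> I"] union_genideal[OF J I] J.a_subset I.a_subset by simp
  have "Idl (insert a A) \<subseteq> Idl (PIdl a \<union> Idl A)"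
  proof (intro genideal_minimal genideal_ideal)
    show "PIdl a \<union> Idl A \<subseteq> carrier R" using K.a_subset J.a_subset by simp
    then show "insert a A \<subseteq> Idl (PIdl a \<union> Idl A)"
      using genideal_self[of "PIdl a \<union> Idl A"] genideal_self[OF Ac] cgenideal_self[OF a] by blast
  qed
  then have gen: "Idl (insert a A) \<subseteq> PIdl a <+>\<^bsub>R\<^esub> Idl A" by (simp add: union_genideal[OF K J])
  have "(PIdl a <+>\<^bsub>R\<^esub> Idl A) [^]\<^bsub>ideals_set R\<^esub> k \<subseteq> PIdl (a [^] k) <+>\<^bsub>R\<^esub> Idl A"
    using ideal_pow_add_subset[OF K J, of k] by (simp add: cgenideal_pow[OF a])
  also have "\<dots> \<subseteq> Idl A <+>\<^bsub>R\<^esub> I"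
    using cgenideal_minimal[OF I k(2)] sub by (intro add_ideals_subset[OF IA]) auto
  finally have step: "(PIdl a <+>\<^bsub>R\<^esub> Idl A) [^]\<^bsub>ideals_set R\<^esub> k \<subseteq> Idl A <+>\<^bsub>R\<^esub> I" .
  have "(Idl (insert a A)) [^]\<^bsub>ideals_set R\<^esub> (k * n) \<subseteq> (PIdl a <+>\<^bsub>R\<^esub> Idl A) [^]\<^bsub>ideals_set R\<^esub> (k * n)"
    by (rule ideal_pow_mono[OF gen])
  also have "\<dots> = ((PIdl a <+>\<^bsub>R\<^esub> Idl A) [^]\<^bsub>ideals_set R\<^esub> k) [^]\<^bsub>ideals_set R\<^esub> n"
    by (rule ideal_pow_pow[OF KJ, symmetric])
  also have "\<dots> \<subseteq> (Idl A <+>\<^bsub>R\<^esub> I) [^]\<^bsub>ideals_set R\<^esub> n" by (rule ideal_pow_mono[OF step])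
  also have "\<dots> \<subseteq> (Idl A) [^]\<^bsub>ideals_set R\<^esub> n <+>\<^bsub>R\<^esub> I" by (rule ideal_pow_add_subset[OF J I])
  also have "\<dots> \<subseteq> I" by (rule add_ideals_subset[OF I n(2) subset_refl])
  finally have "(Idl (insert a A)) [^]\<^bsub>ideals_set R\<^esub> (k * n) \<subseteq> I" .
  moreover have "k * n \<ge> 1" using k(1) n(1) by simp
  ultimately show ?case by blast
qed

text \<open>Both sides say that \<open>\<one>\<close> lies in the saturation.\<close>

lemma saturation_eq_carrier_iff:
  assumes M: "ideal M R" and K: "ideal K R"
  shows "saturation R M K = carrier R \<longleftrightarrow> (\<exists>i\<ge>1::nat. M [^]\<^bsub>ideals_set R\<^esub> i \<subseteq> K)"
proof
  assume "saturation R M K = carrier R"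
  then have "\<one> \<in> saturation R M K" by simp
  then obtain i where i: "i \<ge> (1::nat)" "\<And>y. y \<in> M [^]\<^bsub>ideals_set R\<^esub> i \<Longrightarrow> \<one> \<otimes> y \<in> K"
    unfolding saturation_def colon_def by auto
  have "M [^]\<^bsub>ideals_set R\<^esub> i \<subseteq> K"
    using i(2) ideal.Icarr[OF ideal_pow_ideal[OF M]] by (metis l_one subsetI)
  with i(1) show "\<exists>i\<ge>1::nat. M [^]\<^bsub>ideals_set R\<^esub> i \<subseteq> K" by blast
next
  assume "\<exists>i\<ge>1::nat. M [^]\<^bsub>ideals_set R\<^esub> i \<subseteq> K"
  then obtain i where "i \<ge> (1::nat)" "M [^]\<^bsub>ideals_set R\<^esub> i \<subseteq> K" by blast
  then show "saturation R M K = carrier R"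
    unfolding saturation_def colon_def using ideal.I_l_closed[OF K] by auto
qed

lemma maximalideal_primary_to_self:
  assumes "maximalideal M R"
  shows "primary_to R M M"
proof -
  interpret P: primeideal M R by (rule maximalideal_prime[OF assms])
  have pow: "b \<in> M" if "b \<in> carrier R" "b [^] n \<in> M" for b and n :: nat
    using that
  proof (induction n)
    case 0
    then show ?case using P.one_imp_carrier by auto
  next
    case (Suc n)
    then show ?case using P.I_prime[of "b [^] n" b] by auto
  qed
  have "b [^] (1::nat) \<in> M" if "b \<in> M" for b using that P.Icarr by simp
  then have "primaryideal M R"
    using P.I_notcarr P.I_prime by unfold_locales blast+
  moreover have "radical R M = M"
    unfolding radical_def using pow P.Icarr \<open>\<And>b. b \<in> M \<Longrightarrow> b [^] (1::nat) \<in> M\<close> by blast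
  ultimately show ?thesis by (simp add: primary_to_def)
qed

end

text \<open>Noetherianity enters through the finitely many generators of the radical.\<close>

lemma (in local_ring) saturation_of_primary:
  assumes "primary_to R \<mm> I"
  shows "saturation R \<mm> I = carrier R"
proof -
  interpret I: primaryideal I R using assms by (simp add: primary_to_def)
  interpret M: maximalideal \<mm> R by (rule maximal)
  obtain A where A: "A \<subseteq> carrier R" "finite A" "\<mm> = Idl A"
    using finetely_gen[OF M.is_ideal] by blast
  then have "A \<subseteq> radical R I" using genideal_self[OF A(1)] assms by (simp add: primary_to_def)
  then have "\<exists>n\<ge>1::nat. \<mm> [^]\<^bsub>ideals_set R\<^esub> n \<subseteq> I"
    unfolding A(3) by (rule power_subset_of_generators_in_radical[OF I.is_ideal A(2)])
  then show ?thesis by (simp only: saturation_eq_carrier_iff[OF M.is_ideal I.is_ideal])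
qed


section \<open>Separability in characteristic zero\<close>

lemma (in ring) add_pow_one_mult:
  fixes n :: nat
  assumes "a \<in> carrier R"
  shows "[n] \<cdot> a = ([n] \<cdot> \<one>) \<otimes> a"
  using assms add_pow_ldistr[of \<one> a n] by simp

lemma (in ring) formal_deriv_carrier:
  assumes K: "subring K R" and p: "p \<in> carrier (univ_poly R K)"
  shows "formal_deriv R p \<in> carrier (univ_poly R K)"
proof -
  note K' = subringE[OF K]
  have set_p: "set p \<subseteq> K" using p by (simp add: univ_poly_carrier[symmetric] polynomial_incl)
  have coeff: "coeff p i \<in> K" if "i < length p" for i
    using coeff_img_restrict[of p] set_p that by blast
  have mult: "[n] \<cdot> a \<in> K" if "a \<in> K" for a and n :: nat
    using that K'(1,2,7) by (induction n) (auto simp: add.nat_pow_Suc)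
  have "set (map (\<lambda>i::nat. [i] \<cdot> coeff p i) (rev [1..<length p])) \<subseteq> K"
    using coeff mult by auto
  then show ?thesis
    unfolding formal_deriv_def univ_poly_carrier[symmetric] by (rule normalize_gives_polynomial)
qed

text \<open>The leading entry \<open>n \<cdot> c\<close>, with \<open>n\<close> the degree and \<open>c\<close> the leading coefficient, does not
  vanish, so normalizing removes nothing.\<close>

lemma (in domain) length_formal_deriv:
  assumes char: "char_zero R" and p: "polynomial (carrier R) p"
  shows "length (formal_deriv R p) = length p - 1"
proof (cases "length p \<le> 1")
  case True
  then show ?thesis by (simp add: formal_deriv_def)
next
  case False
  define n where "n = length p - 1"
  have len: "length p = Suc n" "n \<ge> 1" using False by (auto simp: n_def)
  then have ne: "p \<noteq> []" by auto
  have lc: "lead_coeff p \<in> carrier R" "lead_coeff p \<noteq> \<zero>"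
    using p ne by (auto simp: polynomial_def dest: hd_in_set)
  let ?l = "map (\<lambda>i::nat. [i] \<cdot> coeff p i) (rev [1..<length p])"
  have "coeff p n = lead_coeff p" using lead_coeff_simp[OF ne] by (simp add: n_def)
  then have "hd ?l = [n] \<cdot> lead_coeff p" using len by simp
  also have "\<dots> = ([n] \<cdot> \<one>) \<otimes> lead_coeff p" by (rule add_pow_one_mult[OF lc(1)])
  also have "\<dots> \<noteq> \<zero>" using char len(2) lc by (simp add: char_zero_def integral_iff)
  finally have "hd ?l \<noteq> \<zero>" .
  then show ?thesis unfolding formal_deriv_def using normalize_length_eq[of ?l] by simp
qed

text \<open>A common divisor of an irreducible polynomial and its derivative is a unit or an associate of
  the polynomial; the latter is too large to divide the derivative, which is nonzero.\<close>

lemma (in field) separable_elem_of_char_zero: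
  assumes char: "char_zero R" and K: "subfield K R"
    and x: "x \<in> carrier R" "(algebraic over K) x"
  shows "separable_elem R K x"
proof -
  note subr = subfieldE(1)[OF K]
  interpret UP: domain "univ_poly R K" by (rule univ_poly_is_domain[OF subr])
  let ?p = "Irr K x" and ?d = "formal_deriv R (Irr K x)"
  have p: "?p \<in> carrier (univ_poly R K)" and irr: "pirreducible K ?p"
    using IrrE[OF K x] by auto
  have d: "?d \<in> carrier (univ_poly R K)" by (rule formal_deriv_carrier[OF subr p])
  have deg: "degree ?p \<ge> 1" by (rule pirreducible_degree[OF K p irr])
  have len: "length ?d = length ?p - 1"
    using p carrier_polynomial[OF subr] by (intro length_formal_deriv[OF char]) (simp add: univ_poly_carrier)
  then have "?d \<noteq> []" using deg by auto
  have ndvd: "\<not> ?p divides\<^bsub>univ_poly R K\<^esub> ?d"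
  proof
    assume "?p divides\<^bsub>univ_poly R K\<^esub> ?d"
    then have "?p pdivides ?d" by (simp add: pdivides_iff_shell[OF K p d])
    then have "degree ?p \<le> degree ?d"
      by (rule pdivides_imp_degree_le[OF subr p d \<open>?d \<noteq> []\<close>])
    then show False using deg len by simp
  qed
  have "y divides\<^bsub>univ_poly R K\<^esub> \<one>\<^bsub>univ_poly R K\<^esub>"
    if y: "y \<in> carrier (univ_poly R K)" "y divides\<^bsub>univ_poly R K\<^esub> ?p" "y divides\<^bsub>univ_poly R K\<^esub> ?d" for y
  proof -
    have "\<not> ?p divides\<^bsub>univ_poly R K\<^esub> y" using ndvd UP.divides_trans[OF _ y(3)] p by blast
    then have "y \<in> Units (univ_poly R K)"
      using divides_pirreducible_condition[OF irr y(1,2)] by (auto simp: associated_def)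
    then show ?thesis using UP.Unit_eq_dividesone[OF y(1)] by simp
  qed
  moreover have "\<one>\<^bsub>univ_poly R K\<^esub> divides\<^bsub>univ_poly R K\<^esub> q" if "q \<in> carrier (univ_poly R K)" for q
    using that by (auto simp: factor_def)
  ultimately show ?thesis
    using x p d by (simp add: separable_elem_def isgcd_def)
qed

lemma (in ring_hom_ring) char_zero_of_inj:
  assumes "inj_on h (carrier R)" "char_zero R"
  shows "char_zero S"
proof -
  have h: "h ([i] \<cdot> \<one>) = [i] \<cdot>\<^bsub>S\<^esub> \<one>\<^bsub>S\<^esub>" for i :: nat
    by (induction i) (simp_all add: R.add.nat_pow_Suc S.add.nat_pow_Suc)
  have "[i] \<cdot>\<^bsub>S\<^esub> \<one>\<^bsub>S\<^esub> \<noteq> \<zero>\<^bsub>S\<^esub>" if "i > 0" for i :: nat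
  proof
    assume "[i] \<cdot>\<^bsub>S\<^esub> \<one>\<^bsub>S\<^esub> = \<zero>\<^bsub>S\<^esub>"
    then have "h ([i] \<cdot> \<one>) = h \<zero>" by (simp add: h)
    then have "[i] \<cdot> \<one> = \<zero>" using inj_onD[OF assms(1)] by simp
    then show False using assms(2) that by (simp add: char_zero_def)
  qed
  then show ?thesis by (simp add: char_zero_def)
qed


section \<open>Extensions of local rings\<close>

context local_extension
begin

lemma residue_map_ring_hom: "residue_map S \<nn> h \<in> ring_hom (R Quot \<mm>) (S Quot \<nn>)"
proof -
  interpret m: maximalideal \<mm> R by (rule R.maximal)
  interpret n: maximalideal \<nn> S by (rule S.maximal)
  note m_hom = ring_hom_memE[OF m.rcos_ring_hom] and n_hom = ring_hom_memE[OF n.rcos_ring_hom]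
  note h = ring_hom_memE[OF hom]
  have rep: "\<exists>x\<in>carrier R. C = \<mm> +>\<^bsub>R\<^esub> x" if "C \<in> carrier (R Quot \<mm>)" for C
    using that by (auto simp: FactRing_def A_RCOSETS_def')
  show ?thesis
  proof (rule ring_hom_memI)
    fix C assume "C \<in> carrier (R Quot \<mm>)"
    then show "residue_map S \<nn> h C \<in> carrier (S Quot \<nn>)"
      using rep[of C] by (auto simp: residue_map_coset h n_hom)
  next
    fix C D assume "C \<in> carrier (R Quot \<mm>)" "D \<in> carrier (R Quot \<mm>)"
    then obtain x y where xy: "x \<in> carrier R" "C = \<mm> +>\<^bsub>R\<^esub> x" "y \<in> carrier R" "D = \<mm> +>\<^bsub>R\<^esub> y"
      using rep by blast
    have "residue_map S \<nn> h (C \<otimes>\<^bsub>R Quot \<mm>\<^esub> D) = \<nn> +>\<^bsub>S\<^esub> h (x \<otimes>\<^bsub>R\<^esub> y)"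
      unfolding xy using xy(1,3) by (simp only: m_hom(2)[symmetric] residue_map_coset R.m_closed)
    then show "residue_map S \<nn> h (C \<otimes>\<^bsub>R Quot \<mm>\<^esub> D)
        = residue_map S \<nn> h C \<otimes>\<^bsub>S Quot \<nn>\<^esub> residue_map S \<nn> h D"
      unfolding xy using xy(1,3) by (simp only: h n_hom residue_map_coset)
    have "residue_map S \<nn> h (C \<oplus>\<^bsub>R Quot \<mm>\<^esub> D) = \<nn> +>\<^bsub>S\<^esub> h (x \<oplus>\<^bsub>R\<^esub> y)"
      unfolding xy using xy(1,3) by (simp only: m_hom(3)[symmetric] residue_map_coset R.a_closed)
    then show "residue_map S \<nn> h (C \<oplus>\<^bsub>R Quot \<mm>\<^esub> D)
        = residue_map S \<nn> h C \<oplus>\<^bsub>S Quot \<nn>\<^esub> residue_map S \<nn> h D"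
      unfolding xy using xy(1,3) by (simp only: h n_hom residue_map_coset)
  next
    show "residue_map S \<nn> h \<one>\<^bsub>R Quot \<mm>\<^esub> = \<one>\<^bsub>S Quot \<nn>\<^esub>"
      by (simp only: m_hom(4)[symmetric] residue_map_coset[OF R.one_closed] h(4) n_hom(4))
  qed
qed

text \<open>The embedding of \<open>R/\<mm>\<close> into \<open>S/\<nn>\<close> carries characteristic zero over to \<open>S/\<nn>\<close>.\<close>

lemma separable_residue_extension:
  assumes alg: "algebraic_extension (S Quot \<nn>) (residue_image R \<mm> S \<nn> h)"
    and char: "char_zero (R Quot \<mm>)"
  shows "separable_extension (S Quot \<nn>) (residue_image R \<mm> S \<nn> h)"
proof -
  interpret k: field "R Quot \<mm>"
    by (rule maximalideal.quotient_is_field[OF R.maximal R.is_cring])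
  interpret l: field "S Quot \<nn>"
    by (rule maximalideal.quotient_is_field[OF S.maximal S.is_cring])
  interpret f: ring_hom_ring "R Quot \<mm>" "S Quot \<nn>" "residue_map S \<nn> h"
    by (rule ring_hom_ringI2[OF k.ring_axioms l.ring_axioms residue_map_ring_hom])
  note img = f.img_is_subfield[OF k.carrier_is_subfield l.one_not_zero]
  have "char_zero (S Quot \<nn>)" by (rule f.char_zero_of_inj[OF img(1) char])
  then show ?thesis
    using alg img(2) l.separable_elem_of_char_zero
    by (simp add: separable_extension_def algebraic_extension_def residue_image_def over_def)
qed

lemma extended_maximal_ideal_subset: "Idl\<^bsub>S\<^esub> (h ` \<mm>) \<subseteq> \<nn>"
  by (rule S.genideal_minimal[OF maximalideal.axioms(1)[OF S.maximal] local_hom])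

lemma image_subset_carrier: "I \<subseteq> carrier R \<Longrightarrow> h ` I \<subseteq> carrier S"
  using ring_hom_closed[OF hom] by blast

text \<open>With \<open>I\<^sup>s\<^sup>a\<^sup>t = R\<close>, the left-hand side of the equation of saturations is all of \<open>S\<close>.\<close>

lemma saturation_extends_iff:
  assumes I: "primary_to R \<mm> I"
  shows "Idl\<^bsub>S\<^esub> (h ` saturation R \<mm> I) = saturation S \<nn> (Idl\<^bsub>S\<^esub> (h ` I))
    \<longleftrightarrow> (\<exists>i\<ge>1::nat. \<nn> [^]\<^bsub>ideals_set S\<^esub> i \<subseteq> Idl\<^bsub>S\<^esub> (h ` I))"
proof -
  interpret I: primaryideal I R using I by (simp add: primary_to_def)
  have "\<one>\<^bsub>S\<^esub> \<in> h ` carrier R"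
    using imageI[OF R.one_closed, of h] ring_hom_one[OF hom] by simp
  then have "\<one>\<^bsub>S\<^esub> \<in> Idl\<^bsub>S\<^esub> (h ` carrier R)"
    using S.genideal_self[OF image_subset_carrier[OF subset_refl]] by blast
  then have "Idl\<^bsub>S\<^esub> (h ` carrier R) = carrier S"
    by (rule ideal.one_imp_carrier[OF S.genideal_ideal[OF image_subset_carrier[OF subset_refl]]])
  then show ?thesis
    unfolding R.saturation_of_primary[OF I]
    using S.saturation_eq_carrier_iff[OF maximalideal.axioms(1)[OF S.maximal]
        S.genideal_ideal[OF image_subset_carrier[OF I.a_subset]]]
    by metis
qed

text \<open>For \<open>x \<in> \<nn>\<close>, the element \<open>x\<^sup>i \<in> \<nn>\<^sup>i\<close> vanishes in the fiber, which has no nilpotents.\<close>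

lemma maximal_ideal_extends_of_power_subset:
  assumes red: "reduced_ring (S Quot Idl\<^bsub>S\<^esub> (h ` \<mm>))"
    and i: "i \<ge> (1::nat)" "\<nn> [^]\<^bsub>ideals_set S\<^esub> i \<subseteq> Idl\<^bsub>S\<^esub> (h ` \<mm>)"
  shows "Idl\<^bsub>S\<^esub> (h ` \<mm>) = \<nn>"
proof (rule equalityI)
  let ?J = "Idl\<^bsub>S\<^esub> (h ` \<mm>)"
  interpret m: maximalideal \<mm> R by (rule R.maximal)
  interpret n: maximalideal \<nn> S by (rule S.maximal)
  interpret J: ideal ?J S by (rule S.genideal_ideal[OF image_subset_carrier[OF m.a_subset]])
  note q = J.rcos_ring_hom_ring
  have zero: "\<zero>\<^bsub>S Quot ?J\<^esub> = ?J" by (simp add: FactRing_def)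
  show "\<nn> \<subseteq> ?J"
  proof
    fix x assume x: "x \<in> \<nn>"
    have "x [^]\<^bsub>S\<^esub> i \<in> ?J" using pow_mem_ideal_pow[OF S.monoid_axioms x] i(2) by blast
    then have "?J +>\<^bsub>S\<^esub> (x [^]\<^bsub>S\<^esub> i) = \<zero>\<^bsub>S Quot ?J\<^esub>"
      unfolding zero by (rule S.a_rcos_zero[OF J.is_ideal])
    then have "(?J +>\<^bsub>S\<^esub> x) [^]\<^bsub>S Quot ?J\<^esub> i = \<zero>\<^bsub>S Quot ?J\<^esub>"
      by (simp only: ring_hom_ring.hom_nat_pow[OF q n.Icarr[OF x]])
    moreover have "0 < i" using i(1) by simp
    moreover have "?J +>\<^bsub>S\<^esub> x \<in> carrier (S Quot ?J)" by (rule ring_hom_closed[OF J.rcos_ring_hom n.Icarr[OF x]])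
    ultimately have "?J +>\<^bsub>S\<^esub> x = \<zero>\<^bsub>S Quot ?J\<^esub>"
      using red unfolding reduced_ring_def by blast
    then show "x \<in> ?J" unfolding zero by (rule J.rcos_const_imp_mem[OF n.Icarr[OF x]])
  qed
qed (rule extended_maximal_ideal_subset)

end

theorem corollary1p5:
  fixes R :: "('a, 'c) ring_scheme" and S :: "('b, 'd) ring_scheme"
    and \<mm> :: "'a set" and \<nn> :: "'b set" and h :: "'a \<Rightarrow> 'b"
  assumes "local_extension R \<mm> S \<nn> h"
    and "reduced_ring (S Quot Idl\<^bsub>S\<^esub> (h ` \<mm>))"
    and "algebraic_extension (S Quot \<nn>) (residue_image R \<mm> S \<nn> h)"
    and "char_zero (R Quot \<mm>)"
  shows "(\<exists>I. primary_to R \<mm> I \<and>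
            Idl\<^bsub>S\<^esub> (h ` saturation R \<mm> I) = saturation S \<nn> (Idl\<^bsub>S\<^esub> (h ` I)))
         \<longleftrightarrow> unramified R \<mm> S \<nn> h"
proof -
  interpret local_extension R \<mm> S \<nn> h by fact
  interpret m: maximalideal \<mm> R by (rule R.maximal)
  interpret n: maximalideal \<nn> S by (rule S.maximal)
  have m_primary: "primary_to R \<mm> \<mm>" by (rule R.maximalideal_primary_to_self[OF R.maximal])
  have "(\<exists>I. primary_to R \<mm> I \<and>
            Idl\<^bsub>S\<^esub> (h ` saturation R \<mm> I) = saturation S \<nn> (Idl\<^bsub>S\<^esub> (h ` I)))
        \<longleftrightarrow> Idl\<^bsub>S\<^esub> (h ` \<mm>) = \<nn>" (is "?lhs \<longleftrightarrow> ?rhs")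
  proof
    assume ?lhs
    then obtain I i where I: "primary_to R \<mm> I"
      and i: "i \<ge> (1::nat)" "\<nn> [^]\<^bsub>ideals_set S\<^esub> i \<subseteq> Idl\<^bsub>S\<^esub> (h ` I)"
      using saturation_extends_iff by blast
    interpret I: primaryideal I R using I by (simp add: primary_to_def)
    have "x \<in> radical R I" if "x \<in> I" for x
      unfolding radical_def using that I.Icarr by (auto intro!: exI[of _ "1::nat"])
    then have "I \<subseteq> \<mm>" using I by (auto simp: primary_to_def)
    then have "Idl\<^bsub>S\<^esub> (h ` I) \<subseteq> Idl\<^bsub>S\<^esub> (h ` \<mm>)"
      by (intro S.subset_Idl_subset image_subset_carrier m.a_subset image_mono)
    with i show ?rhs by (intro maximal_ideal_extends_of_power_subset[OF assms(2)]) auto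
  next
    assume ?rhs
    then have "\<nn> [^]\<^bsub>ideals_set S\<^esub> (1::nat) \<subseteq> Idl\<^bsub>S\<^esub> (h ` \<mm>)"
      by (simp only: S.ideal_pow_1[OF n.is_ideal])
    then show ?lhs using m_primary saturation_extends_iff[OF m_primary] by blast
  qed
  then show ?thesis
    using separable_residue_extension[OF assms(3,4)] by (simp add: unramified_def)
qed

end
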